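(* Let $R$ be a ring with unit $1$ and let $b,c,d\in R$. Suppose that the group inverses $b^\#$ and $c^\#$ exist and that $k=b^\#b+c^\#c-1$ is invertible in $R$. Put $b^\pi=1-b^\#b$ and $c^\pi=1-c^\#c$. If $b^\pi d=0$ or $dc^\pi=0$, then the group inverse of $\begin{bmatrix}d&b\\ c&0\end{bmatrix}$ exists in $M_2(R)$. If $b^\pi d=0$, then $$\begin{bmatrix}d&b\\ c&0\end{bmatrix}^\#=\begin{bmatrix}-k^{-1}c^\#k^{-1}b^\#k^{-1}dc^\pi k^{-1}&k^{-1}c^\#k^{-1}\\ k^{-1}b^\#k^{-1}(1+dk^{-1}c^\#k^{-1}b^\#k^{-1}dc^\pi k^{-1})&-k^{-1}b^\#k^{-1}dk^{-1}c^\#k^{-1}\end{bmatrix}.$$ If $dc^\pi=0$, then $$\begin{bmatrix}d&b\\ c&0\end{bmatrix}^\#=\begin{bmatrix}-k^{-1}b^\pi dk^{-1}c^\#k^{-1}b^\#k^{-1}&(1+k^{-1}b^\pi dk^{-1}c^\#k^{-1}b^\#k^{-1}d)k^{-1}c^\#k^{-1}\\ k^{-1}b^\#k^{-1}&-k^{-1}b^\#k^{-1}dk^{-1}c^\#k^{-1}\end{bmatrix}.$$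
   Context: For $x$ in a ring with unit (not necessarily commutative), the group inverse of $x$, denoted $x^\#$, is the (unique, if it exists) element $y$ of the ring with $xyx=x$, $yxy=y$, $xy=yx$. $M_2(R)$ is the ring of $2\times2$ matrices over $R$. *)

theory Defs
  imports "HOL-Analysis.Analysis"
begin

text \<open>
  The multiplication is an explicit parameter because the group inverse is needed both in a ring,
  with \<^term>\<open>(*)\<close>, and in its ring of two-by-two matrices, with \<^term>\<open>(**)\<close>: on the type
  \<^typ>\<open>'a^2^2\<close> the symbol \<^term>\<open>(*)\<close> denotes the entrywise product.
\<close>

definition is_group_inverse :: "('a \<Rightarrow> 'a \<Rightarrow> 'a) \<Rightarrow> 'a \<Rightarrow> 'a \<Rightarrow> bool" where
  "is_group_inverse m x y \<longleftrightarrow> m (m x y) x = x \<and> m (m y x) y = y \<and> m x y = m y x"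

definition group_invertible :: "('a \<Rightarrow> 'a \<Rightarrow> 'a) \<Rightarrow> 'a \<Rightarrow> bool" where
  "group_invertible m x \<longleftrightarrow> (\<exists>y. is_group_inverse m x y)"

definition group_inverse :: "('a \<Rightarrow> 'a \<Rightarrow> 'a) \<Rightarrow> 'a \<Rightarrow> 'a" where
  "group_inverse m x = (THE y. is_group_inverse m x y)"

lemma is_group_inverse_unique:
  assumes assoc: "\<And>u v w. m (m u v) w = m u (m v w)"
    and y: "is_group_inverse m x y" and z: "is_group_inverse m x z"
  shows "y = z"
proof -
  have y': "m x (m y x) = x" "m y (m x y) = y" "m x y = m y x"
    using y unfolding is_group_inverse_def assoc by auto
  have z': "m x (m z x) = x" "m z (m x z) = z" "m x z = m z x"
    using z unfolding is_group_inverse_def assoc by auto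
  have "m x y = m x z"
  proof -
    have "m x y = m (m x (m z x)) y" using z' by simp
    also have "\<dots> = m (m x z) (m x y)" by (simp only: assoc)
    also have "\<dots> = m (m z x) (m y x)" by (simp only: y'(3) z'(3))
    also have "\<dots> = m z (m x (m y x))" by (simp only: assoc)
    also have "\<dots> = m x z" by (simp only: y'(1) z'(3))
    finally show ?thesis .
  qed
  have "y = m y (m x z)" using y'(2) \<open>m x y = m x z\<close> by simp
  also have "\<dots> = m (m y x) z" by (simp only: assoc)
  also have "\<dots> = m (m z x) z" using y'(3) z'(3) \<open>m x y = m x z\<close> by simp
  also have "\<dots> = z" by (simp only: assoc z'(2))
  finally show ?thesis .
qed

lemma group_inverse_eqI:
  assumes "\<And>u v w. m (m u v) w = m u (m v w)" and "is_group_inverse m x y"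
  shows "group_inverse m x = y"
  unfolding group_inverse_def
  using assms is_group_inverse_unique[of m x] by blast

text \<open>
  Two-sided inverses in a not necessarily commutative ring; \<^term>\<open>x dvd 1\<close> only expresses
  one-sided invertibility here.
\<close>

definition ring_invertible :: "'a::monoid_mult \<Rightarrow> bool" where
  "ring_invertible x \<longleftrightarrow> (\<exists>y. x * y = 1 \<and> y * x = 1)"

definition ring_inv :: "'a::monoid_mult \<Rightarrow> 'a" where
  "ring_inv x = (THE y. x * y = 1 \<and> y * x = 1)"

lemma ring_inv_eqI:
  fixes x y :: "'a::monoid_mult"
  assumes "x * y = 1" and "y * x = 1"
  shows "ring_inv x = y"
  unfolding ring_inv_def
proof (rule the_equality)
  fix z assume z: "x * z = 1 \<and> z * x = 1"
  have "z = z * (x * y)" using assms by simp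
  also have "\<dots> = (z * x) * y" by (simp add: mult.assoc)
  also have "\<dots> = y" using z by simp
  finally show "z = y" .
qed (use assms in simp)

abbreviation mat22 :: "'a::zero \<Rightarrow> 'a \<Rightarrow> 'a \<Rightarrow> 'a \<Rightarrow> 'a^2^2" where
  "mat22 p q r s \<equiv> vector [vector [p, q], vector [r, s]]"

end

theory Submission
  imports Defs
begin

text \<open>
  Put \<open>e = b b\<^sup>#\<close>, \<open>f = c c\<^sup>#\<close>, \<open>k = e + f - 1\<close>, \<open>x = k\<inverse> c\<^sup># k\<inverse>\<close> and \<open>y = k\<inverse> b\<^sup># k\<inverse>\<close>.
  From \<open>e k = e f = k f\<close> and \<open>f k = f e = k e\<close> one gets \<open>e k\<inverse> e = e\<close> and \<open>f k\<inverse> f = f\<close>, and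
  then \<open>b y = x c = e k\<inverse>\<close> and \<open>y b = c x = f k\<inverse>\<close>. So \<open>y\<close> and \<open>x\<close> are reflexive inverses of \<open>b\<close> and \<open>c\<close>
  exchanging the same two idempotents \<open>g = e k\<inverse>\<close> and \<open>h = f k\<inverse>\<close>, which makes
  \<open>[0, x; y, 0]\<close> the group inverse of \<open>[0, b; c, 0]\<close>. The two hypotheses on \<open>d\<close> say \<open>g d = d\<close>
  and \<open>d g = d\<close>, and \<open>c\<^sup>\<pi> k\<inverse> = k\<inverse> b\<^sup>\<pi> = g - 1\<close>; in these terms the claim is a
  computation in which \<open>k\<close> no longer occurs.
\<close>

lemma mat22_mult:
  fixes p q r s p' q' r' s' :: "'a::semiring_1"
  shows "mat22 p q r s ** mat22 p' q' r' s' =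
    mat22 (p * p' + q * r') (p * q' + q * s') (r * p' + s * r') (r * q' + s * s')"
  by (simp add: vec_eq_iff forall_2 matrix_matrix_mult_def sum_2 vector_2)

lemma group_inverse_matrix_eqI:
  fixes A X :: "'a::semiring_1^'n^'n"
  assumes "is_group_inverse (**) A X"
  shows "group_invertible (**) A" and "group_inverse (**) A = X"
  using assms group_inverse_eqI[OF _ assms]
  by (auto simp: group_invertible_def matrix_mul_assoc)

lemma is_group_inverse_group_inverse:
  fixes b :: "'a::monoid_mult"
  assumes "group_invertible (*) b"
  shows "is_group_inverse (*) b (group_inverse (*) b)"
  using assms group_inverse_eqI[of "(*)" b]
  by (auto simp: group_invertible_def mult.assoc)

lemma is_group_inverse_absorb:
  fixes b bs :: "'a::monoid_mult"
  assumes "is_group_inverse (*) b bs"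
  shows "bs * b * b = b" "b * (bs * b) = b" "bs * b * bs = bs" "bs * (bs * b) = bs"
proof -
  have h: "b * bs * b = b" "bs * b * bs = bs" "b * bs = bs * b"
    using assms unfolding is_group_inverse_def by blast+
  from h(1) show "bs * b * b = b" by (simp only: h(3))
  from h(1) show "b * (bs * b) = b" by (simp only: mult.assoc)
  from h(2) show "bs * b * bs = bs" .
  from h(2) show "bs * (bs * b) = bs" by (simp only: mult.assoc h(3))
qed

lemma ring_inv_inverse:
  fixes k :: "'a::monoid_mult"
  assumes "ring_invertible k"
  shows "k * ring_inv k = 1" and "ring_inv k * k = 1"
  using assms ring_inv_eqI[of k] by (auto simp: ring_invertible_def)

text \<open>\<open>algebra_simps\<close> nests products to the right, where a rule for
  \<open>u * v\<close> cannot match inside a longer product; this gives such a rule a version with a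
  tail \<open>z\<close>.\<close>

lemma mult_left_assoc_eq:
  fixes u v w :: "'a::semigroup_mult"
  assumes "u * v = w"
  shows "u * (v * z) = w * z"
  using assms by (simp flip: mult.assoc)

text \<open>Both \<open>u\<close> and \<open>v\<close> can lend a factor \<open>e\<close>, so the
  middle becomes \<open>e * t * e\<close> and collapses. With \<open>t = ki\<close> this cancels
  inner factors \<open>ki\<close> below.\<close>

lemma mult_sandwich:
  fixes u v e t :: "'a::semigroup_mult"
  assumes "u * e = u" and "e * v = v" and "e * t * e = e"
  shows "u * t * v = u * v"
proof -
  have "u * t * v = (u * e) * t * (e * v)" by (simp only: assms)
  also have "\<dots> = u * (e * t * e) * v" by (simp only: mult.assoc)
  finally show ?thesis by (simp only: assms)
qed

locale exchanged_inverses =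
  fixes b y c x g h :: "'a::ring_1"
  assumes by_eq: "b * y = g" and xc_eq: "x * c = g" and yb_eq: "y * b = h" and cx_eq: "c * x = h"
    and gb: "g * b = b" and gx: "g * x = x" and hc: "h * c = c" and hy: "h * y = y"
begin

text \<open>Associativity turns left absorption into right absorption, as in
  \<open>b * h = b * y * b = g * b = b\<close>.\<close>

lemma idempotent_rules:
  shows "g * g = g" "h * h = h" "b * h = b" "x * h = x" "c * g = c" "y * g = y"
proof -
  show "b * h = b" by (simp only: yb_eq[symmetric] mult.assoc[symmetric] by_eq gb)
  show "x * h = x" by (simp only: cx_eq[symmetric] mult.assoc[symmetric] xc_eq gx)
  show "c * g = c" by (simp only: xc_eq[symmetric] mult.assoc[symmetric] cx_eq hc)
  show "y * g = y" by (simp only: by_eq[symmetric] mult.assoc[symmetric] yb_eq hy)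
  show "g * g = g" "h * h = h"
    by (metis by_eq gb mult.assoc, metis yb_eq hy mult.assoc)
qed

lemmas base_rules = by_eq xc_eq yb_eq cx_eq gb gx hc hy idempotent_rules
lemmas rules = base_rules base_rules[THEN mult_left_assoc_eq]

text \<open>As \<open>g - 1\<close> kills \<open>d\<close> and \<open>b\<close> from the left, both
  products of the two matrices come to \<open>mat22 g 0 (- (y * d * (g - 1))) h\<close>.\<close>

lemma is_group_inverse_mat22_left:
  assumes gd: "g * d = d"
  shows "is_group_inverse (**) (mat22 d b c 0)
    (mat22 (- (x * y * d * (g - 1))) x (y * (1 + d * (x * y) * d * (g - 1))) (- (y * d * x)))"
  unfolding is_group_inverse_def mat22_mult
  by (simp add: algebra_simps rules gd mult_left_assoc_eq[OF gd])

text \<open>Mirror image of the previous case: transposing and passing to the opposite ring swaps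
  \<open>b\<close> with \<open>c\<close> and \<open>x\<close> with \<open>y\<close>, and fixes
  \<open>g\<close> and \<open>h\<close>.\<close>

lemma is_group_inverse_mat22_right:
  assumes dg: "d * g = d"
  shows "is_group_inverse (**) (mat22 d b c 0)
    (mat22 (- ((g - 1) * d * (x * y))) ((1 + (g - 1) * d * (x * y) * d) * x) y (- (y * d * x)))"
  unfolding is_group_inverse_def mat22_mult
  by (simp add: algebra_simps rules dg mult_left_assoc_eq[OF dg])

end

lemma idempotents_inverse_sum:
  fixes e f k ki :: "'a::ring_1"
  assumes ee: "e * e = e" and ff: "f * f = f" and k: "k = e + f - 1"
    and k_ki: "k * ki = 1" and ki_k: "ki * k = 1"
  shows "ki * e = f * ki" "ki * f = e * ki" "e * ki * e = e" "f * ki * f = f"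
    "(1 - f) * ki = e * ki - 1" "ki * (1 - e) = e * ki - 1"
proof -
  have ek: "e * k = k * f" "f * k = k * e"
    by (simp_all add: k algebra_simps ee ff)
  have "ki * (e * k) * ki = f * ki" "ki * (f * k) * ki = e * ki"
    unfolding ek by (simp_all add: mult.assoc[symmetric] ki_k)
  then show swap: "ki * e = f * ki" "ki * f = e * ki"
    by (simp_all add: mult.assoc k_ki)
  \<comment> \<open>These give \<open>e * ki * e = ki * f * e = ki * k * e = e\<close>, and
    symmetrically for \<open>f\<close>.\<close>
  have fe: "f * e = k * e" "e * f = k * f"
    by (simp_all add: k algebra_simps ee ff)
  have "e * ki * e = ki * (f * e)" "f * ki * f = ki * (e * f)"
    by (simp_all flip: swap add: mult.assoc)
  then show "e * ki * e = e" "f * ki * f = f"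
    by (simp_all add: fe mult.assoc[symmetric] ki_k)
  have "e * ki + f * ki - ki = 1"
    using k_ki by (simp add: k algebra_simps)
  then show "(1 - f) * ki = e * ki - 1" "ki * (1 - e) = e * ki - 1"
    by (simp_all add: algebra_simps swap)
qed

theorem proposition4p1:
  fixes b c d bs cs k ki bpi cpi :: "'a::ring_1"
  assumes "group_invertible (*) b" and "group_invertible (*) c"
    and "bs = group_inverse (*) b" and "cs = group_inverse (*) c"
    and "k = bs * b + cs * c - 1"
    and "ring_invertible k" and "ki = ring_inv k"
    and "bpi = 1 - bs * b" and "cpi = 1 - cs * c"
  shows "(bpi * d = 0 \<or> d * cpi = 0 \<longrightarrow> group_invertible (**) (mat22 d b c 0)) \<and>
    (bpi * d = 0 \<longrightarrow>
      group_inverse (**) (mat22 d b c 0) =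
        mat22
          (- (ki * cs * ki * bs * ki * d * cpi * ki))
          (ki * cs * ki)
          (ki * bs * ki * (1 + d * ki * cs * ki * bs * ki * d * cpi * ki))
          (- (ki * bs * ki * d * ki * cs * ki))) \<and>
    (d * cpi = 0 \<longrightarrow>
      group_inverse (**) (mat22 d b c 0) =
        mat22
          (- (ki * bpi * d * ki * cs * ki * bs * ki))
          ((1 + ki * bpi * d * ki * cs * ki * bs * ki * d) * ki * cs * ki)
          (ki * bs * ki)
          (- (ki * bs * ki * d * ki * cs * ki)))"
proof -
  define e f where "e = bs * b" and "f = cs * c"
  have bs: "is_group_inverse (*) b bs" and cs: "is_group_inverse (*) c cs"
    unfolding assms(3,4) using assms(1,2) by (auto intro: is_group_inverse_group_inverse)
  have prods: "b * bs = e" "c * cs = f"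
    using bs cs by (simp_all add: is_group_inverse_def e_def f_def)
  note absorb = is_group_inverse_absorb[OF bs, folded e_def]
    is_group_inverse_absorb[OF cs, folded f_def]
  have idem: "e * e = e" "f * f = f"
    using absorb(3,7) by (simp_all add: e_def f_def flip: mult.assoc)
  have k_eq: "k = e + f - 1"
    by (simp add: assms(5) e_def f_def)
  have inv: "k * ki = 1" "ki * k = 1"
    using ring_inv_inverse[OF assms(6)] by (simp_all add: assms(7))
  note swap = idempotents_inverse_sum[OF idem k_eq inv]
  define x y where "x = ki * cs * ki" and "y = ki * bs * ki"
  have mid: "b * ki * bs = e" "bs * ki * b = e" "c * ki * cs = f" "cs * ki * c = f"
    using mult_sandwich[OF absorb(2,3) swap(3)] mult_sandwich[OF absorb(4,1) swap(3)]
      mult_sandwich[OF absorb(6,7) swap(4)] mult_sandwich[OF absorb(8,5) swap(4)]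
    by (simp_all only: prods e_def[symmetric] f_def[symmetric])
  \<comment> \<open>Rewriting \<open>f * ki\<close> as \<open>ki * e\<close> brings the idempotent
    next to \<open>bs\<close>, which absorbs it; likewise for \<open>cs\<close>.\<close>
  have f_ki_bs: "f * (ki * bs) = ki * bs" and e_ki_cs: "e * (ki * cs) = ki * cs"
    by (simp_all only: mult.assoc[symmetric] swap(1,2)[symmetric])
       (simp_all only: mult.assoc absorb)
  have ex: "e * x = x" and fy: "f * y = y"
    using f_ki_bs e_ki_cs by (simp_all add: x_def y_def flip: mult.assoc)
  \<comment> \<open>Two factors \<open>ki\<close> meet in the middle, but the stated formulas have
    only one; the sandwich by \<open>f\<close> removes the other.\<close>
  have "x * y = ki * (cs * ki * (ki * bs)) * ki"
    by (simp only: x_def y_def mult.assoc)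
  also have "\<dots> = ki * (cs * (ki * bs)) * ki"
    by (simp only: mult_sandwich[OF absorb(8) f_ki_bs swap(4)])
  finally have xy: "x * y = ki * cs * ki * bs * ki"
    by (simp only: mult.assoc)
  interpret exchanged_inverses b y c x "e * ki" "f * ki"
  proof
    show "b * y = e * ki" "c * x = f * ki"
      by (simp_all only: x_def y_def mult.assoc[symmetric] mid)
    have "x * c = ki * (cs * ki * c)" "y * b = ki * (bs * ki * b)"
      by (simp_all only: x_def y_def mult.assoc)
    then show "x * c = e * ki" "y * b = f * ki"
      by (simp_all only: mid swap)
    show "e * ki * b = b" "f * ki * c = c" "e * ki * x = x" "f * ki * y = y"
      using mult_sandwich[OF idem(1) _ swap(3)] mult_sandwich[OF idem(2) _ swap(4)]
        absorb ex fy by simp_all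
  qed
  have pis: "cpi * ki = e * ki - 1" "ki * bpi = e * ki - 1"
    using swap(5,6) by (simp_all add: assms(8,9) e_def f_def)
  have left: "is_group_inverse (**) (mat22 d b c 0)
    (mat22
      (- (ki * cs * ki * bs * ki * d * cpi * ki))
      (ki * cs * ki)
      (ki * bs * ki * (1 + d * ki * cs * ki * bs * ki * d * cpi * ki))
      (- (ki * bs * ki * d * ki * cs * ki)))" if "bpi * d = 0"
  proof -
    have "e * d = d"
      using that by (simp add: assms(8) e_def algebra_simps)
    then have "e * ki * d = d"
      using mult_sandwich[OF idem(1) _ swap(3)] by simp
    from is_group_inverse_mat22_left[OF this, unfolded xy pis(1)[symmetric], unfolded x_def y_def]
    show ?thesis
      by (simp only: mult.assoc)
  qed
  have right: "is_group_inverse (**) (mat22 d b c 0)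
    (mat22
      (- (ki * bpi * d * ki * cs * ki * bs * ki))
      ((1 + ki * bpi * d * ki * cs * ki * bs * ki * d) * ki * cs * ki)
      (ki * bs * ki)
      (- (ki * bs * ki * d * ki * cs * ki)))" if "d * cpi = 0"
  proof -
    have "d * f = d"
      using that by (simp add: assms(9) f_def algebra_simps)
    \<comment> \<open>Reading \<open>e * ki\<close> as \<open>ki * f\<close> lets
      \<open>d * f = d\<close> cancel \<open>ki\<close>.\<close>
    then have "d * (e * ki) = d"
      using mult_sandwich[OF _ idem(2) swap(4), of d]
      by (simp only: swap(2)[symmetric] mult.assoc[symmetric])
    from is_group_inverse_mat22_right[OF this, unfolded xy pis(2)[symmetric], unfolded x_def y_def]
    show ?thesis
      by (simp only: mult.assoc)
  qed
  show ?thesis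
    using group_inverse_matrix_eqI[OF left] group_inverse_matrix_eqI[OF right] by blast
qed

end
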